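(* Let $X\in\mathbb{R}^{n\times p}$ with $X\ne0$, $y\in\mathbb{R}^n$, $\lambda_1\ge\lambda_2\ge\cdots\ge\lambda_p>0$, let $v\ge1$ be an integer, and let $P(\beta)=\tfrac12\|y-X\beta\|^2+J(\beta)$ with $J(\beta)=\sum_{j=1}^p\lambda_j|\beta_{(j)}|$, where $|\beta_{(1)}|\ge\cdots\ge|\beta_{(p)}|$. Let $\beta^*$ be a minimizer of $P$ over $\mathbb{R}^p$, and let $(\beta^{(t)})_{t\ge0}$ be the iterates generated from an arbitrary starting point $\beta^{(0)}\in\mathbb{R}^p$ by the hybrid coordinate descent and proximal gradient descent algorithm described in the context. Then $$\lim_{t\to\infty}\bigl(P(\beta^{(t)})-P(\beta^* )\bigr)=0 .$$
   Context: Conventions: $\operatorname{sign}(x)=x/|x|$ for $x\ne0$, $\operatorname{sign}(0)=1$; $\|\cdot\|$ is the Euclidean norm and $\|X\|_2$ the spectral norm of $X$. For $f$ proper closed convex, $\operatorname{prox}_f(u)=\arg\min_{w}\ f(w)+\tfrac12\|w-u\|^2$. Clusters of a vector $\beta\in\mathbb{R}^p$: if $|\beta_j|$ takes exactly $m$ distinct values $c_1>\cdots>c_m\ge0$, the clusters are $\mathcal{C}_i=\{j:|\beta_j|=c_i\}$, $i=1,\dots,m$ (so $m$, the $c_i$ and the $\mathcal{C}_i$ depend on $\beta$ and are ordered by decreasing value). Algorithm. For $t=0,1,2,\dots$, $\beta^{(t+1)}$ is obtained from $\beta=\beta^{(t)}$ as follows. (1) If $t\bmod v=0$ (proximal gradient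 step): $\beta^{(t+1)}=\operatorname{prox}_{J/\|X\|_2^2}\Bigl(\beta-\frac{1}{\|X\|_2^2}X^T(X\beta-y)\Bigr)$. (2) Otherwise (coordinate descent pass over clusters): set $k=1$. While $k\le m$, where $m$ is the number of clusters of the current $\beta$: let $\mathcal{C}_k$ be the $k$-th cluster of the current $\beta$; for $z\in\mathbb{R}$ let $\beta(z)$ be the vector with $\beta_i(z)=\operatorname{sign}(\beta_i)z$ for $i\in\mathcal{C}_k$ and $\beta_i(z)=\beta_i$ for $i\notin\mathcal{C}_k$; let $\hat z$ be the minimizer over $z\in\mathbb{R}$ of $z\mapsto P(\beta(z))$ (it is unique because all $\lambda_j>0$); replace $\beta$ by $\beta(\hat z)$; recompute the clusters and their values for the new $\beta$; and replace $k$ by $k+1$. When the loop ends, $\beta^{(t+1)}$ is the current $\beta$. *)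

theory Defs
  imports "HOL-Analysis.Analysis" "HOL-Library.Multiset" "HOL-Library.While_Combinator"
begin

text \<open>Unlike \<^const>\<open>sgn\<close>, the sign of \<open>0\<close> is \<open>1\<close> here.\<close>

definition sign1 :: "real \<Rightarrow> real" where
  "sign1 x = (if x = 0 then 1 else x / \<bar>x\<bar>)"

definition spectral_norm :: "real^'p^'n \<Rightarrow> real" where
  "spectral_norm X = onorm (\<lambda>b. X *v b)"

text \<open>Only finite-valued functions are needed, so \<open>f\<close> takes values in \<^typ>\<open>real\<close>. For convex
  continuous \<open>f\<close> the minimizer exists and is unique, hence \<^const>\<open>arg_min\<close> involves no choice.\<close>

definition prox :: "(real^'p \<Rightarrow> real) \<Rightarrow> real^'p \<Rightarrow> real^'p" where
  "prox f u = arg_min (\<lambda>w. f w + 1/2 * (norm (w - u))\<^sup>2) (\<lambda>_. True)"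

text \<open>\<open>abs_order b j\<close> is $|b_{(j)}|$, the \<open>j\<close>-th largest absolute value counted with
  multiplicity, for \<open>j\<close> between \<open>1\<close> and \<open>p\<close>.\<close>

definition abs_order :: "real^'p \<Rightarrow> nat \<Rightarrow> real" where
  "abs_order b j =
     rev (sorted_list_of_multiset (image_mset (\<lambda>i. \<bar>b $ i\<bar>) (mset_set UNIV))) ! (j - 1)"

text \<open>The weights $\lambda_1, \dots, \lambda_p$ are the values of \<open>lam\<close> on \<open>{1..CARD('p)}\<close>;
  its values elsewhere are never used.\<close>

definition slope_pen :: "(nat \<Rightarrow> real) \<Rightarrow> real^'p \<Rightarrow> real" where
  "slope_pen lam b = (\<Sum>j = 1..CARD('p). lam j * abs_order b j)"

definition slope_obj :: "real^'p^'n \<Rightarrow> real^'n \<Rightarrow> (nat \<Rightarrow> real) \<Rightarrow> real^'p \<Rightarrow> real" where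
  "slope_obj X y lam b = 1/2 * (norm (y - X *v b))\<^sup>2 + slope_pen lam b"

definition num_clusters :: "real^'p \<Rightarrow> nat" where
  "num_clusters b = card (range (\<lambda>j. \<bar>b $ j\<bar>))"

text \<open>The \<open>k\<close>-th largest distinct absolute value $c_k$, for \<open>k\<close> between \<open>1\<close> and
  \<open>num_clusters b\<close>.\<close>

definition cluster_value :: "real^'p \<Rightarrow> nat \<Rightarrow> real" where
  "cluster_value b k = rev (sorted_list_of_set (range (\<lambda>j. \<bar>b $ j\<bar>))) ! (k - 1)"

definition cluster :: "real^'p \<Rightarrow> nat \<Rightarrow> 'p set" where
  "cluster b k = {j. \<bar>b $ j\<bar> = cluster_value b k}"

definition set_cluster :: "real^'p \<Rightarrow> nat \<Rightarrow> real \<Rightarrow> real^'p" where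
  "set_cluster b k z = (\<chi> i. if i \<in> cluster b k then sign1 (b $ i) * z else b $ i)"

definition cluster_update ::
    "real^'p^'n \<Rightarrow> real^'n \<Rightarrow> (nat \<Rightarrow> real) \<Rightarrow> nat \<Rightarrow> real^'p \<Rightarrow> real^'p" where
  "cluster_update X y lam k b =
     set_cluster b k (arg_min (\<lambda>z. slope_obj X y lam (set_cluster b k z)) (\<lambda>_. True))"

text \<open>The loop guard refers to the clusters of the current vector. The loop terminates because
  \<open>num_clusters b \<le> CARD('p)\<close> for every \<open>b\<close>.\<close>

definition cd_pass ::
    "real^'p^'n \<Rightarrow> real^'n \<Rightarrow> (nat \<Rightarrow> real) \<Rightarrow> real^'p \<Rightarrow> real^'p" where
  "cd_pass X y lam b =
     snd (while (\<lambda>(k, b). k \<le> num_clusters b)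
                (\<lambda>(k, b). (k + 1, cluster_update X y lam k b))
                (1, b))"

definition pgd_step ::
    "real^'p^'n \<Rightarrow> real^'n \<Rightarrow> (nat \<Rightarrow> real) \<Rightarrow> real^'p \<Rightarrow> real^'p" where
  "pgd_step X y lam b =
     prox (\<lambda>w. slope_pen lam w / (spectral_norm X)\<^sup>2)
          (b - (1 / (spectral_norm X)\<^sup>2) *\<^sub>R (transpose X *v (X *v b - y)))"

primrec hybrid_iter ::
    "real^'p^'n \<Rightarrow> real^'n \<Rightarrow> (nat \<Rightarrow> real) \<Rightarrow> nat \<Rightarrow> real^'p \<Rightarrow> nat \<Rightarrow> real^'p" where
  "hybrid_iter X y lam v b0 0 = b0"
| "hybrid_iter X y lam v b0 (Suc t) =
     (if t mod v = 0 then pgd_step X y lam (hybrid_iter X y lam v b0 t)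
      else cd_pass X y lam (hybrid_iter X y lam v b0 t))"

end

theory Submission
  imports Defs
begin

text \<open>The objective never increases along the iteration, and since \<open>\<lambda>\<close> is positive the iterates
  stay bounded, at distance at most \<open>R\<close> from \<open>\<beta>\<^sup>*\<close>. A proximal gradient step minimizes a quadratic
  upper model of the objective; comparing its value with that of the model at
  \<open>\<beta> + s (\<beta>\<^sup>* - \<beta>)\<close> and using convexity of the objective, the suboptimality \<open>\<delta>\<close> becomes at most
  \<open>(1 - s) \<delta> + s\<^sup>2 L R\<^sup>2 / 2\<close> with \<open>L = \<parallel>X\<parallel>\<^sup>2\<close>, for every \<open>s \<in> [0, 1]\<close>. As such a step occurs
  infinitely often, the limit \<open>d\<close> of the suboptimality satisfies \<open>d \<le> s L R\<^sup>2 / 2\<close> for all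
  \<open>s \<in> (0, 1]\<close>, so \<open>d = 0\<close>. Convexity of the sorted penalty comes from the rearrangement
  inequality, which exhibits it as a maximum over bijections of weighted absolute sums.\<close>

section \<open>Rearrangement inequality and sorted absolute values\<close>

text \<open>Induction on \<open>n\<close>: one swap of values makes the permutation fix the last
  index without lowering the sum, and the rest is the case \<open>n\<close>.\<close>

lemma rearrangement_permutes:
  fixes a l :: "nat \<Rightarrow> real"
  assumes "\<And>i j. 1 \<le> i \<Longrightarrow> i \<le> j \<Longrightarrow> j \<le> n \<Longrightarrow> l j \<le> l i"
    and "\<And>i j. 1 \<le> i \<Longrightarrow> i \<le> j \<Longrightarrow> j \<le> n \<Longrightarrow> a j \<le> a i"
    and "p permutes {1..n}"
  shows "(\<Sum>i = 1..n. l i * a (p i)) \<le> (\<Sum>i = 1..n. l i * a i)"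
  using assms
proof (induction n arbitrary: p)
  case 0
  then show ?case by simp
next
  case (Suc n)
  let ?m = "Suc n"
  define r where "r = Transposition.transpose ?m (p ?m) \<circ> p"
  have ins: "{1..?m} = insert ?m {1..n}"
    by auto
  have r_perm: "r permutes {1..n}"
    unfolding r_def by (rule permutes_insert_lemma) (use Suc.prems(3) ins in simp)
  have r_m: "r ?m = ?m"
    by (simp add: r_def)
  have "(\<Sum>i = 1..?m. l i * a (p i)) \<le> (\<Sum>i = 1..?m. l i * a (r i))"
  proof (cases "p ?m = ?m")
    case True
    then show ?thesis by (simp add: r_def)
  next
    case False
    have pm: "p ?m \<in> {1..?m}"
      using permutes_in_image[OF Suc.prems(3), of ?m] by simp
    obtain q where q: "p q = ?m"
      using permutes_surj[OF Suc.prems(3)] by (metis surj_def)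
    have "q \<in> {1..?m}"
      using permutes_in_image[OF Suc.prems(3), of q] q by simp
    with q False have qn: "q \<in> {1..n}"
      by (cases "q = ?m") auto
    have rq: "r q = p ?m"
      by (simp add: r_def q)
    have other: "r i = p i" if "i \<in> {1..n} - {q}" for i
    proof -
      have "p i \<noteq> ?m" "p i \<noteq> p ?m"
        using that q qn inj_eq[OF permutes_inj[OF Suc.prems(3)]] by (force, force)
      then show ?thesis by (simp add: r_def transpose_apply_other)
    qed
    have split: "(\<Sum>i = 1..?m. f i) = f ?m + (f q + (\<Sum>i \<in> {1..n} - {q}. f i))"
      for f :: "nat \<Rightarrow> real"
      using sum.remove[OF _ qn, of f] by simp
    have "l ?m \<le> l q" "a ?m \<le> a (p ?m)"
      using qn pm Suc.prems(1)[of q ?m] Suc.prems(2)[of "p ?m" ?m] by auto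
    \<comment> \<open>This product is exactly the change in the sum caused by swapping the values of
      \<open>p\<close> at \<open>q\<close> and \<open>?m\<close>.\<close>
    then have "0 \<le> (l q - l ?m) * (a (p ?m) - a ?m)"
      by simp
    moreover have "(\<Sum>i \<in> {1..n} - {q}. l i * a (r i)) = (\<Sum>i \<in> {1..n} - {q}. l i * a (p i))"
      by (rule sum.cong) (simp_all add: other)
    ultimately show ?thesis
      unfolding split by (simp add: rq r_m q algebra_simps)
  qed
  also have "\<dots> \<le> (\<Sum>i = 1..?m. l i * a i)"
    using Suc.IH[OF _ _ r_perm] Suc.prems(1,2) by (simp add: r_m)
  finally show ?case .
qed

text \<open>Sorting the coordinates by absolute value, rather than the values alone, yields a
  bijection \<open>e\<close> along which sums can be reindexed.\<close>

lemma abs_order_enumeration: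
  fixes b :: "real^'p"
  obtains e where "bij_betw e {1..CARD('p)} (UNIV :: 'p set)"
    and "\<And>j. j \<in> {1..CARD('p)} \<Longrightarrow> abs_order b j = \<bar>b $ e j\<bar>"
    and "\<And>i j. 1 \<le> i \<Longrightarrow> i \<le> j \<Longrightarrow> j \<le> CARD('p) \<Longrightarrow> \<bar>b $ e j\<bar> \<le> \<bar>b $ e i\<bar>"
proof -
  obtain xs :: "'p list" where xs: "set xs = UNIV" "distinct xs"
    using finite_distinct_list[of "UNIV :: 'p set"] by auto
  let ?f = "\<lambda>i. \<bar>b $ i\<bar>"
  define ys where "ys = rev (sort_key ?f xs)"
  have ys: "set ys = UNIV" "distinct ys"
    using xs by (simp_all add: ys_def)
  have len: "length ys = CARD('p)"
    using distinct_card[OF ys(2)] ys(1) by simp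
  have mset: "mset_set (UNIV :: 'p set) = mset xs"
    using xs by (metis mset_set_set)
  have srt: "sort (map ?f xs) = map ?f (sort_key ?f xs)"
    by (rule properties_for_sort) simp_all
  have ord: "abs_order b j = map ?f ys ! (j - 1)" for j
    by (simp add: abs_order_def mset srt ys_def rev_map flip: mset_map)
  have sorted: "sorted (rev (map ?f ys))"
    by (simp add: ys_def rev_map)
  show thesis
  proof
    \<comment> \<open>Ranks start at 1, list positions at 0.\<close>
    have "bij_betw (\<lambda>j. j - 1) {1..CARD('p)} {..<CARD('p)}"
      by (rule bij_betw_byWitness[where f' = Suc]) auto
    moreover have "bij_betw ((!) ys) {..<CARD('p)} UNIV"
      by (rule bij_betw_nth) (use ys len in auto)
    ultimately show "bij_betw (\<lambda>j. ys ! (j - 1)) {1..CARD('p)} UNIV"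
      using bij_betw_trans unfolding comp_def by blast
    show "abs_order b j = ?f (ys ! (j - 1))" if "j \<in> {1..CARD('p)}" for j
      using that len by (auto simp: ord)
    show "?f (ys ! (j - 1)) \<le> ?f (ys ! (i - 1))"
      if "1 \<le> i" "i \<le> j" "j \<le> CARD('p)" for i j
      using sorted_rev_nth_mono[OF sorted, of "i - 1" "j - 1"] that len by auto
  qed
qed

section \<open>Existence of minimizers\<close>

text \<open>\<open>arg_min\<close> is a choice operator, so attainment must be shown before its
  value can be compared. Outside the ball of radius \<open>f 0 / c\<close> the function exceeds
  \<open>f 0\<close>, so a minimum over this compact ball is global.\<close>

lemma arg_min_le_of_coercive:
  fixes f :: "'a::euclidean_space \<Rightarrow> real"
  assumes cont: "continuous_on UNIV f" and c: "0 < c" and coercive: "\<And>x. c * norm x \<le> f x"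
  shows "f (arg_min f (\<lambda>_. True)) \<le> f x"
proof -
  define r where "r = f 0 / c"
  have "0 \<le> f 0"
    using coercive[of 0] by simp
  then have "0 \<in> cball (0 :: 'a) r"
    using c by (simp add: r_def)
  then obtain m where m: "m \<in> cball 0 r" "\<And>z. z \<in> cball 0 r \<Longrightarrow> f m \<le> f z"
    using continuous_attains_inf[of "cball 0 r" f] continuous_on_subset[OF cont]
    by (metis compact_cball emptyE subset_UNIV)
  have "f m \<le> f z" for z
  proof (cases "z \<in> cball 0 r")
    case False
    then have "f 0 < c * norm z"
      using c by (simp add: r_def field_simps)
    then show ?thesis
      using coercive[of z] m(2)[OF \<open>0 \<in> cball 0 r\<close>] by linarith
  qed (rule m(2))
  then show ?thesis
    by (subst arg_min_equality[of "\<lambda>_. True" m f]) simp_all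
qed

section \<open>Spectral norm and quadratic expansions\<close>

lemma spectral_norm_pos:
  fixes X :: "real^'p^'n"
  assumes "X \<noteq> 0"
  shows "0 < spectral_norm X"
proof -
  have "\<not> (\<forall>b. X *v b = 0)"
    using assms matrix_eq[of X 0] by simp
  then show ?thesis
    by (simp add: spectral_norm_def onorm_pos_lt)
qed

text \<open>Second-order Taylor expansion at \<open>b\<close>, exact because the loss is
  quadratic.\<close>

lemma half_norm_residual_expand:
  fixes X :: "real^'p^'n"
  shows "1/2 * (norm (y - X *v w))\<^sup>2 = 1/2 * (norm (y - X *v b))\<^sup>2
    + (transpose X *v (X *v b - y)) \<bullet> (w - b) + 1/2 * (norm (X *v (w - b)))\<^sup>2"
proof -
  have grad: "(transpose X *v (X *v b - y)) \<bullet> (w - b) = (X *v b - y) \<bullet> (X *v (w - b))"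
    by (simp add: dot_lmul_matrix)
  define r d where "r = y - X *v b" and "d = X *v (w - b)"
  have w: "y - X *v w = r - d"
    by (simp add: r_def d_def matrix_vector_mult_diff_distrib)
  have "1/2 * (norm (r - d))\<^sup>2 = 1/2 * (norm r)\<^sup>2 - r \<bullet> d + 1/2 * (norm d)\<^sup>2"
    by (simp add: power2_norm_eq_inner inner_diff_left inner_diff_right inner_commute[of d r])
  moreover have "(X *v b - y) \<bullet> d = - (r \<bullet> d)"
    by (simp add: r_def flip: inner_minus_left)
  ultimately show ?thesis
    unfolding grad w by (simp add: r_def d_def)
qed

text \<open>Completing the square: up to a term free of \<open>w\<close>, the proximal distance
  scaled by \<open>L\<close> is the linear-plus-quadratic model at \<open>b\<close>.\<close>

lemma norm_prox_argument:
  fixes g w b :: "'a::real_inner"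
  assumes "L \<noteq> 0"
  shows "L * (1/2 * (norm (w - (b - (1 / L) *\<^sub>R g)))\<^sup>2)
    = L / 2 * (norm (w - b))\<^sup>2 + g \<bullet> (w - b) + (norm g)\<^sup>2 / (2 * L)"
proof -
  define d where "d = w - b"
  have w: "w - (b - (1 / L) *\<^sub>R g) = d + (1 / L) *\<^sub>R g"
    by (simp add: d_def)
  have "(norm (d + (1 / L) *\<^sub>R g))\<^sup>2 = (norm d)\<^sup>2 + 2 * (g \<bullet> d) / L + (norm g)\<^sup>2 / L\<^sup>2"
    by (simp only: power2_norm_eq_inner inner_add_left inner_add_right
          inner_scaleR_left inner_scaleR_right inner_commute[of d g])
       (use assms in \<open>simp add: field_simps power2_eq_square\<close>)
  then show ?thesis
    unfolding w d_def[symmetric] using assms by (simp add: field_simps power2_eq_square)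
qed

section \<open>Convexity and coercivity of penalty and objective\<close>

text \<open>The type argument \<open>P\<close> ties the weights to the index type \<open>'p\<close>,
  whose cardinality is their number.\<close>

locale slope_weights =
  fixes lam :: "nat \<Rightarrow> real" and P :: "'p::finite itself"
  assumes lam_mono: "\<And>i j. 1 \<le> i \<Longrightarrow> i \<le> j \<Longrightarrow> j \<le> CARD('p) \<Longrightarrow> lam j \<le> lam i"
    and lam_pos: "\<And>j. 1 \<le> j \<Longrightarrow> j \<le> CARD('p) \<Longrightarrow> 0 < lam j"
begin

lemma slope_pen_attained:
  fixes b :: "real^'p"
  obtains e where "bij_betw e {1..CARD('p)} (UNIV :: 'p set)"
    and "slope_pen lam b = (\<Sum>j = 1..CARD('p). lam j * \<bar>b $ e j\<bar>)"
proof -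
  obtain e where "bij_betw e {1..CARD('p)} (UNIV :: 'p set)"
    and "\<And>j. j \<in> {1..CARD('p)} \<Longrightarrow> abs_order b j = \<bar>b $ e j\<bar>"
    and "\<And>i j. 1 \<le> i \<Longrightarrow> i \<le> j \<Longrightarrow> j \<le> CARD('p) \<Longrightarrow> \<bar>b $ e j\<bar> \<le> \<bar>b $ e i\<bar>"
    by (rule abs_order_enumeration[of b]) (rule that)
  then show thesis
    by (intro that[of e]) (simp_all add: slope_pen_def)
qed

text \<open>Any two enumerations of the coordinates differ by a permutation of the ranks, so the
  rearrangement inequality compares \<open>e'\<close> with the sorting one.\<close>

lemma slope_pen_ge:
  fixes b :: "real^'p"
  assumes e': "bij_betw e' {1..CARD('p)} (UNIV :: 'p set)"
  shows "(\<Sum>j = 1..CARD('p). lam j * \<bar>b $ e' j\<bar>) \<le> slope_pen lam b"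
proof -
  let ?S = "{1..CARD('p)}"
  obtain e where e: "bij_betw e ?S (UNIV :: 'p set)"
    and ord: "\<And>j. j \<in> ?S \<Longrightarrow> abs_order b j = \<bar>b $ e j\<bar>"
    and mono: "\<And>i j. 1 \<le> i \<Longrightarrow> i \<le> j \<Longrightarrow> j \<le> CARD('p) \<Longrightarrow> \<bar>b $ e j\<bar> \<le> \<bar>b $ e i\<bar>"
    by (rule abs_order_enumeration[of b]) (rule that)
  define s where "s = inv_into ?S e \<circ> e'"
  \<comment> \<open>\<open>permutes\<close> demands the identity outside \<open>?S\<close>, so
    \<open>s\<close> is extended accordingly.\<close>
  define r where "r i = (if i \<in> ?S then s i else i)" for i
  have "bij_betw s ?S ?S"
    unfolding s_def by (rule bij_betw_trans[OF e' bij_betw_inv_into[OF e]])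
  moreover have "bij_betw r ?S ?S = bij_betw s ?S ?S"
    by (rule bij_betw_cong) (simp add: r_def)
  ultimately have "bij_betw r ?S ?S"
    by simp
  then have r: "r permutes ?S"
    by (rule bij_imp_permutes) (auto simp: r_def)
  have er: "e (r j) = e' j" if "j \<in> ?S" for j
    using that bij_betw_inv_into_right[OF e] by (simp add: r_def s_def)
  have "(\<Sum>j\<in>?S. lam j * \<bar>b $ e' j\<bar>) = (\<Sum>j\<in>?S. lam j * \<bar>b $ e (r j)\<bar>)"
    by (rule sum.cong) (simp_all add: er)
  also have "\<dots> \<le> (\<Sum>j\<in>?S. lam j * \<bar>b $ e j\<bar>)"
    by (rule rearrangement_permutes[where a = "\<lambda>i. \<bar>b $ e i\<bar>", OF lam_mono mono r])
  also have "\<dots> = slope_pen lam b"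
    by (simp add: slope_pen_def ord)
  finally show ?thesis .
qed

text \<open>The enumeration that attains the penalty at the convex combination is a competitor at
  both endpoints.\<close>

lemma convex_slope_pen: "convex_on UNIV (slope_pen lam :: real^'p \<Rightarrow> real)"
proof (rule convex_onI)
  fix t :: real and a b :: "real^'p"
  assume t: "0 < t" "t < 1"
  let ?w = "(1 - t) *\<^sub>R a + t *\<^sub>R b"
  obtain e where e: "bij_betw e {1..CARD('p)} (UNIV :: 'p set)"
    and w: "slope_pen lam ?w = (\<Sum>j = 1..CARD('p). lam j * \<bar>?w $ e j\<bar>)"
    by (rule slope_pen_attained[of ?w])
  have "slope_pen lam ?w
      \<le> (\<Sum>j = 1..CARD('p). (1 - t) * (lam j * \<bar>a $ e j\<bar>) + t * (lam j * \<bar>b $ e j\<bar>))"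
    unfolding w
  proof (rule sum_mono)
    fix j assume j: "j \<in> {1..CARD('p)}"
    have "\<bar>?w $ e j\<bar> \<le> (1 - t) * \<bar>a $ e j\<bar> + t * \<bar>b $ e j\<bar>"
      using t abs_triangle_ineq[of "(1 - t) * a $ e j" "t * b $ e j"] by (simp add: abs_mult)
    then have "lam j * \<bar>?w $ e j\<bar> \<le> lam j * ((1 - t) * \<bar>a $ e j\<bar> + t * \<bar>b $ e j\<bar>)"
      using lam_pos[of j] j by (intro mult_left_mono) auto
    then show "lam j * \<bar>?w $ e j\<bar> \<le> (1 - t) * (lam j * \<bar>a $ e j\<bar>) + t * (lam j * \<bar>b $ e j\<bar>)"
      by (simp add: algebra_simps)
  qed
  also have "\<dots> = (1 - t) * (\<Sum>j = 1..CARD('p). lam j * \<bar>a $ e j\<bar>)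
      + t * (\<Sum>j = 1..CARD('p). lam j * \<bar>b $ e j\<bar>)"
    by (simp add: sum.distrib sum_distrib_left)
  also have "\<dots> \<le> (1 - t) * slope_pen lam a + t * slope_pen lam b"
    using t by (intro add_mono mult_left_mono slope_pen_ge e) auto
  finally show "slope_pen lam ?w \<le> (1 - t) * slope_pen lam a + t * slope_pen lam b" .
qed simp

lemma continuous_slope_pen:
  assumes "continuous_on S g"
  shows "continuous_on S (\<lambda>x. slope_pen lam (g x :: real^'p))"
  using convex_on_continuous[OF open_UNIV convex_slope_pen] assms
  by (rule continuous_on_compose2) simp

lemma lam_last_pos: "0 < lam CARD('p)"
  by (rule lam_pos) (simp_all add: Suc_le_eq)

text \<open>Lowering all weights to the smallest leaves a multiple of the l1 norm, which dominates
  the Euclidean norm. This coercivity gives both existence of minimizers and boundedness of the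
  iterates.\<close>

lemma norm_le_slope_pen: "lam CARD('p) * norm b \<le> slope_pen lam (b :: real^'p)"
proof -
  obtain e where e: "bij_betw e {1..CARD('p)} (UNIV :: 'p set)"
    and b: "slope_pen lam b = (\<Sum>j = 1..CARD('p). lam j * \<bar>b $ e j\<bar>)"
    by (rule slope_pen_attained[of b])
  have "lam CARD('p) * norm b \<le> lam CARD('p) * (\<Sum>i\<in>UNIV. \<bar>b $ i\<bar>)"
    using lam_last_pos norm_le_l1_cart[of b] by simp
  also have "\<dots> = (\<Sum>j = 1..CARD('p). lam CARD('p) * \<bar>b $ e j\<bar>)"
    by (simp only: sum.reindex_bij_betw[OF e, of "\<lambda>i. \<bar>b $ i\<bar>"] flip: sum_distrib_left)
  also have "\<dots> \<le> slope_pen lam b"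
    unfolding b by (intro sum_mono mult_right_mono lam_mono) auto
  finally show ?thesis .
qed

lemma norm_le_slope_obj:
  "lam CARD('p) * norm b \<le> slope_obj X y lam (b :: real^'p)"
  using norm_le_slope_pen[of b] by (simp add: slope_obj_def add_increasing)

lemma continuous_slope_obj:
  assumes "continuous_on S g"
  shows "continuous_on S (\<lambda>x. slope_obj X y lam (g x :: real^'p))"
  unfolding slope_obj_def
  by (intro continuous_intros continuous_slope_pen assms
      bounded_linear.continuous_on[OF matrix_vector_mul_bounded_linear])

section \<open>Descent of the coordinate pass\<close>

lemma cluster_update_le:
  fixes b :: "real^'p"
  shows "slope_obj X y lam (cluster_update X y lam k b) \<le> slope_obj X y lam b"
proof -
  let ?f = "\<lambda>z. slope_obj X y lam (set_cluster b k z)"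
  \<comment> \<open>The current vector is itself a candidate of the line search, since
    \<open>sign1 x * \<bar>x\<bar> = x\<close>.\<close>
  have self: "set_cluster b k (cluster_value b k) = b"
    by (auto simp: set_cluster_def vec_eq_iff cluster_def sign1_def)
  have min: "?f (arg_min ?f (\<lambda>_. True)) \<le> ?f z" for z
  \<comment> \<open>For arbitrary \<open>k\<close> the cluster may be empty; the objective is then
    constant in \<open>z\<close> and coercivity fails.\<close>
  proof (cases "cluster b k = {}")
    case True
    then show ?thesis by (simp add: set_cluster_def)
  next
    case False
    then obtain i where i: "i \<in> cluster b k"
      by auto
    show ?thesis
    proof (rule arg_min_le_of_coercive[OF _ lam_last_pos])
      have "continuous_on UNIV (\<lambda>z. (set_cluster b k z) $ j)" for j
        by (cases "j \<in> cluster b k") (auto simp: set_cluster_def intro!: continuous_intros)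
      then have "continuous_on UNIV (set_cluster b k)"
        by (subst continuous_on_componentwise)
           (auto simp: Basis_vec_def inner_axis)
      then show "continuous_on UNIV ?f"
        by (rule continuous_slope_obj)
      fix z :: real
      \<comment> \<open>Also true at \<open>b $ i = 0\<close>, by the convention
        \<open>sign1 0 = 1\<close>; hence coercivity in \<open>z\<close> holds for the zero cluster
        too.\<close>
      have "\<bar>sign1 (b $ i)\<bar> = 1"
        by (simp add: sign1_def)
      then have "norm z \<le> norm (set_cluster b k z)"
        using component_le_norm_cart[of "set_cluster b k z" i] i
        by (simp add: set_cluster_def abs_mult)
      then have "lam CARD('p) * norm z \<le> lam CARD('p) * norm (set_cluster b k z)"
        using lam_last_pos by simp
      also have "\<dots> \<le> ?f z"
        by (rule norm_le_slope_obj)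
      finally show "lam CARD('p) * norm z \<le> ?f z" .
    qed
  qed
  show ?thesis
    using min[of "cluster_value b k"] by (simp add: cluster_update_def self)
qed

lemma num_clusters_le_card: "num_clusters (b :: real^'p) \<le> CARD('p)"
  by (simp add: num_clusters_def card_image_le)

lemma cd_pass_le:
  fixes b :: "real^'p"
  shows "slope_obj X y lam (cd_pass X y lam b) \<le> slope_obj X y lam b"
proof -
  let ?c = "\<lambda>(k, b :: real^'p). k \<le> num_clusters b"
  let ?body = "\<lambda>(k, b). (k + 1, cluster_update X y lam k b)"
  let ?I = "\<lambda>s. slope_obj X y lam (snd s) \<le> slope_obj X y lam b"
  have "?I (while ?c ?body (1, b))"
  \<comment> \<open>Updates may change the number of clusters, so the measure uses the uniform bound
    \<open>CARD('p)\<close>.\<close>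
  proof (rule while_rule[where P = ?I and r = "inv_image less_than (\<lambda>s. CARD('p) + 1 - fst s)"])
    show "?I (?body s)" if "?I s" for s
      using order_trans[OF cluster_update_le that] by (simp add: case_prod_beta)
    show "(?body s, s) \<in> inv_image less_than (\<lambda>s. CARD('p) + 1 - fst s)" if "?c s" for s
      using that order_trans[OF _ num_clusters_le_card, of "fst s" "snd s"]
      by (simp add: case_prod_beta diff_less_mono2)
  qed simp_all
  then show ?thesis
    by (simp add: cd_pass_def)
qed

section \<open>Progress of the proximal gradient step\<close>

text \<open>The comparison point \<open>w\<close> is free: \<open>w = b\<close> gives descent, a
  point towards a minimizer gives quantitative progress.\<close>

lemma pgd_step_le:
  fixes X :: "real^'p^'n"
  assumes "X \<noteq> 0"
  shows "slope_obj X y lam (pgd_step X y lam b)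
    \<le> slope_obj X y lam w + (spectral_norm X)\<^sup>2 / 2 * (norm (w - b))\<^sup>2"
proof -
  define L where "L = (spectral_norm X)\<^sup>2"
  have L: "0 < L"
    using spectral_norm_pos[OF assms] by (simp add: L_def)
  define g where "g = transpose X *v (X *v b - y)"
  define u where "u = b - (1 / L) *\<^sub>R g"
  let ?h = "\<lambda>w. slope_pen lam w / L + 1/2 * (norm (w - u))\<^sup>2"
  define p where "p = pgd_step X y lam b"
  have p: "p = arg_min ?h (\<lambda>_. True)"
    by (simp add: p_def pgd_step_def prox_def u_def g_def L_def)
  have h_le: "?h p \<le> ?h w"
    unfolding p
  proof (rule arg_min_le_of_coercive[where c = "lam CARD('p) / L"])
    show "continuous_on UNIV ?h"
      using L by (intro continuous_intros continuous_slope_pen) auto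
    show "0 < lam CARD('p) / L"
      using L lam_last_pos by simp
    show "lam CARD('p) / L * norm x \<le> ?h x" for x
      using L divide_right_mono[OF norm_le_slope_pen[of x], of L] by (simp add: add_increasing2)
  qed
  have h_eq: "L * ?h z = slope_pen lam z + (L / 2 * (norm (z - b))\<^sup>2 + g \<bullet> (z - b) + (norm g)\<^sup>2 / (2 * L))"
    for z
    using L norm_prox_argument[of L z b g] by (simp add: u_def distrib_left)
  have "L * ?h p \<le> L * ?h w"
    using h_le L by simp
  then have model: "slope_pen lam p + L / 2 * (norm (p - b))\<^sup>2 + g \<bullet> (p - b)
      \<le> slope_pen lam w + L / 2 * (norm (w - b))\<^sup>2 + g \<bullet> (w - b)"
    unfolding h_eq by linarith
  have "norm (X *v (p - b)) \<le> spectral_norm X * norm (p - b)"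
    unfolding spectral_norm_def by (rule onorm) simp
  then have "(norm (X *v (p - b)))\<^sup>2 \<le> L * (norm (p - b))\<^sup>2"
    unfolding L_def power_mult_distrib[symmetric] by (rule power_mono) simp
  \<comment> \<open>In the expansion at \<open>b\<close>, the curvature term is bounded above by
    \<open>L\<close> at \<open>p\<close> and below by 0 at \<open>w\<close>.\<close>
  then show ?thesis
    using model zero_le_power2[of "norm (X *v (w - b))"] half_norm_residual_expand[of y X p b] half_norm_residual_expand[of y X w b]
    unfolding slope_obj_def g_def[symmetric] L_def[symmetric] p_def[symmetric]
    by linarith
qed

lemma convex_slope_obj: "convex_on UNIV (slope_obj X y lam :: real^'p \<Rightarrow> real)"
proof -
  have "convex_on UNIV (\<lambda>b. (norm (y - X *v b))\<^sup>2)"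
  proof (rule convex_onI)
    fix t :: real and a b :: "real^'p"
    assume t: "0 < t" "t < 1"
    define u where "u = y - X *v a"
    define z where "z = y - X *v b"
    have "y - X *v ((1 - t) *\<^sub>R a + t *\<^sub>R b) = (1 - t) *\<^sub>R u + t *\<^sub>R z"
      by (simp add: u_def z_def matrix_vector_right_distrib matrix_vector_mult_scaleR algebra_simps)
    \<comment> \<open>The subtracted term is the convexity gap of the squared norm.\<close>
    moreover have "(norm ((1 - t) *\<^sub>R u + t *\<^sub>R z))\<^sup>2
        = (1 - t) * (norm u)\<^sup>2 + t * (norm z)\<^sup>2 - t * (1 - t) * (norm (u - z))\<^sup>2"
      by (simp only: power2_norm_eq_inner inner_add_left inner_add_right inner_diff_left
            inner_diff_right inner_scaleR_left inner_scaleR_right inner_commute[of z u]) algebra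
    moreover have "0 \<le> t * (1 - t) * (norm (u - z))\<^sup>2"
      using t by simp
    ultimately show "(norm (y - X *v ((1 - t) *\<^sub>R a + t *\<^sub>R b)))\<^sup>2
        \<le> (1 - t) * (norm (y - X *v a))\<^sup>2 + t * (norm (y - X *v b))\<^sup>2"
      by (simp add: u_def z_def)
  qed simp
  then have "convex_on UNIV (\<lambda>b. 1/2 * (norm (y - X *v b))\<^sup>2 + slope_pen lam b)"
    by (intro convex_on_add convex_on_cmul convex_slope_pen) auto
  then show ?thesis
    by (simp add: slope_obj_def[abs_def])
qed

text \<open>Comparison with the point a fraction \<open>s\<close> of the way from \<open>b\<close>
  to \<open>c\<close>: the gain is linear in \<open>s\<close>, the error quadratic.\<close>

lemma pgd_step_suboptimality:
  fixes X :: "real^'p^'n"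
  assumes "X \<noteq> 0" "0 \<le> s" "s \<le> 1"
  shows "slope_obj X y lam (pgd_step X y lam b)
    \<le> (1 - s) * slope_obj X y lam b + s * slope_obj X y lam c
      + (spectral_norm X)\<^sup>2 / 2 * (s * norm (c - b))\<^sup>2"
proof -
  let ?w = "(1 - s) *\<^sub>R b + s *\<^sub>R c"
  have "?w - b = s *\<^sub>R (c - b)"
    by (simp add: algebra_simps)
  then have "norm (?w - b) = s * norm (c - b)"
    using assms(2) by simp
  then show ?thesis
    using pgd_step_le[OF assms(1), of y b ?w] convex_onD[OF convex_slope_obj assms(2,3), of b c X y]
    by simp
qed

section \<open>Monotonicity and convergence\<close>

lemma hybrid_iter_decseq:
  fixes X :: "real^'p^'n"
  assumes "X \<noteq> 0"
  shows "decseq (\<lambda>t. slope_obj X y lam (hybrid_iter X y lam v b0 t))"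
  using pgd_step_le[OF assms, of y b b for b] by (auto intro!: decseq_SucI cd_pass_le)

end

theorem lemma2p6:
  fixes X :: "real^'p^'n" and y :: "real^'n" and lam :: "nat \<Rightarrow> real" and v :: nat
    and b_star b0 :: "real^'p"
  assumes "X \<noteq> 0"
    and "\<And>i j. 1 \<le> i \<Longrightarrow> i \<le> j \<Longrightarrow> j \<le> CARD('p) \<Longrightarrow> lam j \<le> lam i"
    and "\<And>j. 1 \<le> j \<Longrightarrow> j \<le> CARD('p) \<Longrightarrow> 0 < lam j"
    and "1 \<le> v"
    and "\<And>b. slope_obj X y lam b_star \<le> slope_obj X y lam b"
  shows "(\<lambda>t. slope_obj X y lam (hybrid_iter X y lam v b0 t) - slope_obj X y lam b_star)
           \<longlonglongrightarrow> 0"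
proof -
  interpret slope_weights lam "TYPE('p)"
    by standard (use assms(2,3) in auto)
  define B where "B = hybrid_iter X y lam v b0"
  define F where "F b = slope_obj X y lam b - slope_obj X y lam b_star" for b
  define L where "L = (spectral_norm X)\<^sup>2"
  \<comment> \<open>The first summand bounds every iterate, by coercivity and descent from
    \<open>b0\<close>; the triangle inequality adds the second.\<close>
  define R where "R = slope_obj X y lam b0 / lam CARD('p) + norm b_star"
  have dec: "decseq (\<lambda>t. F (B t))"
    using hybrid_iter_decseq[OF assms(1), of y v b0] by (simp add: F_def B_def decseq_def)
  have F_nonneg: "0 \<le> F b" for b
    using assms(5)[of b] by (simp add: F_def)
  obtain d where d: "(\<lambda>t. F (B t)) \<longlonglongrightarrow> d"
    using decseq_convergent[OF dec, of 0] F_nonneg by blast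
  have d_nonneg: "0 \<le> d"
    using LIMSEQ_le_const[OF d] F_nonneg by blast
  have R: "norm (b_star - B t) \<le> R" for t
  proof -
    have "lam CARD('p) * norm (B t) \<le> slope_obj X y lam (B t)"
      by (rule norm_le_slope_obj)
    also have "\<dots> \<le> slope_obj X y lam b0"
      using decseqD[OF dec, of 0 t] by (simp add: F_def B_def)
    finally have "norm (B t) \<le> slope_obj X y lam b0 / lam CARD('p)"
      using lam_last_pos by (simp add: field_simps)
    then show ?thesis
      using norm_triangle_ineq4[of b_star "B t"] by (simp add: R_def)
  qed
  have bound: "d \<le> s * (L / 2 * R\<^sup>2)" if s: "0 < s" "s \<le> 1" for s
  proof -
    \<comment> \<open>Index \<open>v * k\<close> is a multiple of \<open>v\<close>, so the next
      update is a proximal gradient step.\<close>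
    have step: "F (B (Suc (v * k))) \<le> (1 - s) * F (B (v * k)) + L / 2 * (s * R)\<^sup>2" for k
    proof -
      have "(s * norm (b_star - B (v * k)))\<^sup>2 \<le> (s * R)\<^sup>2"
        using s R[of "v * k"] by (intro power_mono mult_left_mono) auto
      then have "L / 2 * (s * norm (b_star - B (v * k)))\<^sup>2 \<le> L / 2 * (s * R)\<^sup>2"
        by (intro mult_left_mono) (simp_all add: L_def)
      moreover have "B (Suc (v * k)) = pgd_step X y lam (B (v * k))"
        by (simp add: B_def)
      moreover have "(1 - s) * F (B (v * k)) = (1 - s) * slope_obj X y lam (B (v * k))
          + s * slope_obj X y lam b_star - slope_obj X y lam b_star"
        by (simp add: F_def algebra_simps)
      ultimately show ?thesis
        using pgd_step_suboptimality[OF assms(1), of s y "B (v * k)" b_star] s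
        by (simp add: F_def L_def)
    qed
    \<comment> \<open>Since \<open>v\<close> is positive, both sides of \<open>step\<close> run
      along genuine subsequences and share the limit \<open>d\<close>.\<close>
    have "strict_mono (\<lambda>k. v * k)" "strict_mono (\<lambda>k. Suc (v * k))"
      using assms(4) by (simp_all add: strict_mono_def)
    then have "(\<lambda>k. F (B (v * k))) \<longlonglongrightarrow> d" "(\<lambda>k. F (B (Suc (v * k)))) \<longlonglongrightarrow> d"
      using LIMSEQ_subseq_LIMSEQ[OF d] by (fastforce simp: comp_def)+
    then have "d \<le> (1 - s) * d + L / 2 * (s * R)\<^sup>2"
      by (intro LIMSEQ_le[where X = "\<lambda>k. F (B (Suc (v * k)))"
            and Y = "\<lambda>k. (1 - s) * F (B (v * k)) + L / 2 * (s * R)\<^sup>2"])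
         (use step in \<open>auto intro!: tendsto_intros\<close>)
    \<comment> \<open>Cancelling \<open>(1 - s) * d\<close> leaves one factor \<open>s\<close> on
      the left and two on the right; this surplus factor forces \<open>d \<le> 0\<close> as
      \<open>s\<close> tends to 0.\<close>
    then have "s * d \<le> s * (s * (L / 2 * R\<^sup>2))"
      by (simp add: algebra_simps power2_eq_square)
    then show ?thesis
      using s(1) by simp
  qed
  have "d \<le> 0"
  proof (rule tendsto_lowerbound)
    show "((\<lambda>s. s * (L / 2 * R\<^sup>2)) \<longlongrightarrow> 0) (at_right 0)"
      by (auto intro!: tendsto_eq_intros)
    show "\<forall>\<^sub>F s in at_right 0. d \<le> s * (L / 2 * R\<^sup>2)"
      using bound by (auto simp: eventually_at_right_field intro!: exI[of _ 1])
  qed simp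
  with d d_nonneg show ?thesis
    by (simp add: F_def B_def)
qed

end
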